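(* Let $$\mathbf{A}=\begin{pmatrix}0&1&1\\1&0&1\\1&1&0\end{pmatrix},$$ let $(w_n)_{n\in\mathbb{N}_0}$ be a sequence of vectors in $[0,\infty)^3$, let $d_0\in\mathbb{R}^3$, and let $(d_n)_{n\in\mathbb{N}_0}$ be the sequence in $\mathbb{R}^3$ defined by $d_{n+1}=\mathbf{A}d_n+w_n$ for all $n\in\mathbb{N}_0$. Then for all $n\in\mathbb{N}_0$, $$d_n=\mathbf{A}^nd_0+\sum_{\nu=0}^{n-1}\mathbf{A}^{\nu}w_{n-\nu-1}.$$
   Context: $\mathbb{N}_0$ denotes the nonnegative integers; vectors are column vectors; an empty sum is zero. *)

theory Defs
  imports "HOL-Analysis.Analysis"
begin

text \<open>The overloaded \<open>^\<close> on \<open>'a ^ 'n ^ 'n\<close> is the componentwise power; this one is the power with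
  respect to the matrix product \<open>**\<close>.\<close>

primrec mat_power :: "('a::semiring_1) ^ 'n ^ 'n \<Rightarrow> nat \<Rightarrow> 'a ^ 'n ^ 'n" where
  "mat_power M 0 = mat 1"
| "mat_power M (Suc k) = M ** mat_power M k"

definition A_mat :: "real ^ 3 ^ 3" where
  "A_mat = vector [vector [0, 1, 1],
                   vector [1, 0, 1],
                   vector [1, 1, 0]]"

end

theory Submission
  imports Defs
begin

text \<open>This is the discrete variation-of-constants formula: the input \<open>w k\<close>, added at step \<open>k + 1\<close>,
  is multiplied by the matrix once in each of the remaining \<open>n - k - 1\<close> steps, and linearity lets
  these contributions be summed. The induction on \<open>n\<close> applies the recurrence to the formula, which
  raises every exponent by one; the new input \<open>w n\<close> supplies the term with exponent \<open>0\<close>.\<close>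

lemma affine_recurrence_solution:
  fixes M :: "real ^ 'n ^ 'n" and w d :: "nat \<Rightarrow> real ^ 'n"
  assumes rec: "\<And>n. d (Suc n) = M *v d n + w n"
  shows "d n = mat_power M n *v d 0 + (\<Sum>\<nu><n. mat_power M \<nu> *v w (n - \<nu> - 1))"
proof (induction n)
  case 0
  show ?case by simp
next
  case (Suc n)
  have "M *v (\<Sum>\<nu><n. mat_power M \<nu> *v w (n - \<nu> - 1))
      = (\<Sum>\<nu><n. mat_power M (Suc \<nu>) *v w (n - \<nu> - 1))"
    by (simp add: linear_sum[OF matrix_vector_mul_linear] matrix_vector_mul_assoc)
  then have "d (Suc n) = mat_power M (Suc n) *v d 0
      + ((\<Sum>\<nu><n. mat_power M (Suc \<nu>) *v w (n - \<nu> - 1)) + w n)"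
    using rec[of n] Suc.IH
    by (simp add: matrix_vector_right_distrib matrix_vector_mul_assoc add.assoc)
  also have "(\<Sum>\<nu><n. mat_power M (Suc \<nu>) *v w (n - \<nu> - 1)) + w n
      = (\<Sum>\<nu><Suc n. mat_power M \<nu> *v w (Suc n - \<nu> - 1))"
    by (simp add: sum.lessThan_Suc_shift del: sum.lessThan_Suc)
  finally show ?case .
qed

theorem proposition1:
  fixes w d :: "nat \<Rightarrow> real ^ 3"
  assumes w_nonneg: "\<And>n i. 0 \<le> w n $ i"
    and d_rec: "\<And>n. d (Suc n) = A_mat *v d n + w n"
  shows "\<forall>n. d n = mat_power A_mat n *v d 0
           + (\<Sum>\<nu><n. mat_power A_mat \<nu> *v w (n - \<nu> - 1))"
  using affine_recurrence_solution[of d A_mat w, OF d_rec] by blast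

end
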